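(* Let $G$ be a distance-regular graph of order $n$ with distance eigenvalues $\partial_1,\dots,\partial_n$. Then the distance Seidel eigenvalues of the Cartesian product $G\times K_2$ are $-1-4\partial_r$ for $r=1,\dots,n$ (each once), $2n-1$ (once), and $-1$ with multiplicity $n-1$.
   Context: The distance eigenvalues of a connected graph are the eigenvalues of its distance matrix $\mathcal{D}(G)=(d_G(v_r,v_t))$. The distance Seidel matrix is $\mathcal{D}^S(G)=J-I-2\mathcal{D}(G)$ ($J$ all-ones), with eigenvalues called distance Seidel eigenvalues. The Cartesian product $G_1\times G_2$ has vertex set $V(G_1)\times V(G_2)$, with $(v_1,u_1)\sim(v_2,u_2)$ iff ($v_1=v_2$ and $u_1u_2\in E(G_2)$) or ($u_1=u_2$ and $v_1v_2\in E(G_1)$). A connected graph is distance-regular if for all vertices $x,y$ with $d(x,y)=i$, the numbers of neighbours of $y$ at distance $i-1$, $i$, $i+1$ from $x$ depend only on $i$. *)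

theory Defs
  imports
    "Graph_Theory.Graph_Theory"
    "Jordan_Normal_Form.Char_Poly"
begin

text \<open>
  Finite simple graphs are \<^locale>\<open>pair_graph\<close>s: finite, loop-free digraphs on a set of ordered
  pairs whose arc relation is symmetric.
\<close>

text \<open>Length of a shortest walk; a junk value if there is no walk from \<open>u\<close> to \<open>v\<close>.\<close>

definition graph_dist :: "'a pair_pre_digraph \<Rightarrow> 'a \<Rightarrow> 'a \<Rightarrow> nat" where
  "graph_dist G u v = (LEAST k. \<exists>p. pre_digraph.awalk (with_proj G) u p v \<and> length p = k)"

text \<open>It is the library's shortest-path cost for unit weights.\<close>

lemma (in pair_wf_digraph) graph_dist_eq_mu:
  assumes "u \<rightarrow>\<^sup>*\<^bsub>with_proj G\<^esub> v"
  shows "ereal (real (graph_dist G u v)) = \<mu> (\<lambda>_. 1) u v"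
proof -
  have cost: "awalk_cost (\<lambda>_. 1) p = real (length p)" for p :: "('a \<times> 'a) list"
    by (induct p) auto
  obtain p where "awalk u p v" using assms reachable_awalk by auto
  then have ex: "\<exists>k p. awalk u p v \<and> length p = k" by blast
  obtain q where q: "awalk u q v" "length q = graph_dist G u v"
    using LeastI_ex[OF ex] unfolding graph_dist_def by blast
  have le: "graph_dist G u v \<le> length p" if "awalk u p v" for p
    unfolding graph_dist_def using that by (auto intro: Least_le)
  show ?thesis
    unfolding \<mu>_def cost
    by (rule sym, rule INF_eqI) (use le in auto, metis q)
qed

text \<open>
  \<open>c i\<close>, \<open>a i\<close>, \<open>b i\<close> are the numbers of neighbours of \<open>y\<close> at distance
  \<open>i - 1\<close>, \<open>i\<close>, \<open>i + 1\<close> from \<open>x\<close>, where \<open>i\<close> is the distance of \<open>x\<close> and \<open>y\<close>.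
  The library's connectedness excludes the graph without vertices.
\<close>

definition distance_regular :: "'a pair_pre_digraph \<Rightarrow> bool" where
  "distance_regular G \<longleftrightarrow> pair_graph G \<and> Digraph_Component.connected (with_proj G) \<and>
     (\<exists>c a b :: nat \<Rightarrow> nat. \<forall>i. \<forall>x \<in> pverts G. \<forall>y \<in> pverts G. graph_dist G x y = i \<longrightarrow>
        card {z. (y, z) \<in> parcs G \<and> graph_dist G x z + 1 = i} = c i \<and>
        card {z. (y, z) \<in> parcs G \<and> graph_dist G x z = i} = a i \<and>
        card {z. (y, z) \<in> parcs G \<and> graph_dist G x z = i + 1} = b i)"

definition cartesian_product ::
    "'a pair_pre_digraph \<Rightarrow> 'b pair_pre_digraph \<Rightarrow> ('a \<times> 'b) pair_pre_digraph" where
  "cartesian_product G H =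
    \<lparr> pverts = pverts G \<times> pverts H,
      parcs = {((v1, u1), (v2, u2)). v1 \<in> pverts G \<and> v2 \<in> pverts G \<and> u1 \<in> pverts H \<and> u2 \<in> pverts H \<and>
        (v1 = v2 \<and> (u1, u2) \<in> parcs H \<or> u1 = u2 \<and> (v1, v2) \<in> parcs G)} \<rparr>"

text \<open>
  Matrices are indexed by positions in a list \<open>vs\<close> that enumerates the vertices without repetition.
\<close>

definition vertex_enumeration :: "'a pair_pre_digraph \<Rightarrow> 'a list \<Rightarrow> bool" where
  "vertex_enumeration G vs \<longleftrightarrow> distinct vs \<and> set vs = pverts G"

definition distance_matrix :: "'a pair_pre_digraph \<Rightarrow> 'a list \<Rightarrow> real mat" where
  "distance_matrix G vs =
    mat (length vs) (length vs) (\<lambda>(r, t). real (graph_dist G (vs ! r) (vs ! t)))"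

definition all_ones_mat :: "nat \<Rightarrow> real mat" where
  "all_ones_mat m = mat m m (\<lambda>_. 1)"

definition distance_seidel_matrix :: "'a pair_pre_digraph \<Rightarrow> 'a list \<Rightarrow> real mat" where
  "distance_seidel_matrix G vs =
    all_ones_mat (length vs) - 1\<^sub>m (length vs) - 2 \<cdot>\<^sub>m distance_matrix G vs"

text \<open>
  \<open>M\<close> is the multiset of all eigenvalues of \<open>A\<close>, with (algebraic) multiplicities. The matrices above
  are real symmetric for an undirected graph, so such a real multiset always exists.
\<close>

definition eigenvalue_multiset :: "real mat \<Rightarrow> real multiset \<Rightarrow> bool" where
  "eigenvalue_multiset A M \<longleftrightarrow> char_poly A = (\<Prod>e\<in>#M. [:- e, 1:])"

definition distance_eigenvalues :: "'a pair_pre_digraph \<Rightarrow> real multiset \<Rightarrow> bool" where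
  "distance_eigenvalues G M \<longleftrightarrow>
    (\<forall>vs. vertex_enumeration G vs \<longrightarrow> eigenvalue_multiset (distance_matrix G vs) M)"

definition distance_seidel_eigenvalues :: "'a pair_pre_digraph \<Rightarrow> real multiset \<Rightarrow> bool" where
  "distance_seidel_eigenvalues G M \<longleftrightarrow>
    (\<forall>vs. vertex_enumeration G vs \<longrightarrow> eigenvalue_multiset (distance_seidel_matrix G vs) M)"

end

theory Submission
  imports Defs
begin

text \<open>
  Distances in a Cartesian product add up. Listing the vertices of \<open>G \<times> K\<^sub>2\<close> one copy of \<open>G\<close> after
  the other, the distance Seidel matrix therefore becomes the block matrix with diagonal blocks
  \<open>A = J - I - 2D\<close> and off-diagonal blocks \<open>B = - J - 2D\<close>. Its characteristic polynomial is the
  product of those of \<open>A + B = - I - 4D\<close> and \<open>A - B = 2J - I\<close>.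
\<close>

section \<open>Distances in Cartesian products\<close>

context pair_wf_digraph
begin

text \<open>Turns walks into relation powers, so that distances become least exponents. The conjunct
  \<open>u \<in> pverts G\<close> matters at \<open>k = 0\<close>: the zeroth power relates every
  element of the type to itself, but an empty walk needs a vertex.\<close>

lemma awalk_length_iff_relpow:
  "(\<exists>p. awalk u p v \<and> length p = k) \<longleftrightarrow> u \<in> pverts G \<and> (u, v) \<in> parcs G ^^ k"
proof (induction k arbitrary: u)
  case 0
  show ?case by (auto simp: awalk_Nil_iff)
next
  case (Suc k)
  have "(\<exists>p. awalk u p v \<and> length p = Suc k) \<longleftrightarrow>
      (\<exists>e q. awalk u (e # q) v \<and> length q = k)"
    by (auto simp only: length_Suc_conv)
  also have "\<dots> \<longleftrightarrow> (\<exists>w. (u, w) \<in> parcs G \<and> (\<exists>q. awalk w q v \<and> length q = k))"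
    by (simp add: awalk_Cons_iff split_paired_Ex)
  \<comment> \<open>\<open>relpow\<close> splits off the last arc and \<open>awalk_Cons_iff\<close>
    the first; \<open>relpow_commute\<close> reconciles them.\<close>
  also have "\<dots> \<longleftrightarrow> u \<in> pverts G \<and> (u, v) \<in> parcs G ^^ Suc k"
    unfolding Suc.IH relpow.simps relpow_commute[symmetric] by (auto intro: wellformed')
  finally show ?case .
qed

lemma graph_dist_eq_Least_relpow:
  "u \<in> pverts G \<Longrightarrow> graph_dist G u v = (LEAST k. (u, v) \<in> parcs G ^^ k)"
  unfolding graph_dist_def awalk_length_iff_relpow by simp

lemma graph_dist_le:
  "u \<in> pverts G \<Longrightarrow> (u, v) \<in> parcs G ^^ k \<Longrightarrow> graph_dist G u v \<le> k"
  by (simp add: graph_dist_eq_Least_relpow Least_le)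

lemma graph_dist_relpow:
  "u \<in> pverts G \<Longrightarrow> (u, v) \<in> parcs G ^^ k \<Longrightarrow> (u, v) \<in> parcs G ^^ graph_dist G u v"
  unfolding graph_dist_eq_Least_relpow by (rule LeastI)

lemma reachable_graph_dist_relpow:
  assumes "u \<rightarrow>\<^sup>*\<^bsub>with_proj G\<^esub> v"
  shows "(u, v) \<in> parcs G ^^ graph_dist G u v"
proof -
  obtain p where "awalk u p v"
    using assms reachable_awalk by auto
  then show ?thesis
    using awalk_length_iff_relpow graph_dist_relpow by metis
qed

end

lemma cartesian_product_simps [simp]:
  "pverts (cartesian_product G H) = pverts G \<times> pverts H"
  "((v, u), (w, t)) \<in> parcs (cartesian_product G H) \<longleftrightarrow>
     v \<in> pverts G \<and> w \<in> pverts G \<and> u \<in> pverts H \<and> t \<in> pverts H \<and>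
     (v = w \<and> (u, t) \<in> parcs H \<or> u = t \<and> (v, w) \<in> parcs G)"
  by (auto simp: cartesian_product_def)

lemma pair_wf_digraph_cartesian_product: "pair_wf_digraph (cartesian_product G H)"
  by unfold_locales auto

text \<open>Every arc of the product moves exactly one coordinate; \<open>i\<close> and
  \<open>j\<close> count the moves of each kind. This yields the lower bound on product
  distances.\<close>

lemma relpow_cartesian_product_split:
  assumes "((v, u), (w, t)) \<in> parcs (cartesian_product G H) ^^ k"
  shows "\<exists>i j. i + j = k \<and> (v, w) \<in> parcs G ^^ i \<and> (u, t) \<in> parcs H ^^ j"
  using assms
proof (induction k arbitrary: w t)
  case 0
  then show ?case by simp
next
  case (Suc k)
  from Suc.prems obtain w' t' where
    walk: "((v, u), (w', t')) \<in> parcs (cartesian_product G H) ^^ k" and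
    arc: "((w', t'), (w, t)) \<in> parcs (cartesian_product G H)"
    by auto
  from Suc.IH[OF walk] obtain i j where
    ij: "i + j = k" "(v, w') \<in> parcs G ^^ i" "(u, t') \<in> parcs H ^^ j"
    by blast
  from arc consider "w' = w" "(t', t) \<in> parcs H" | "t' = t" "(w', w) \<in> parcs G"
    by auto
  then show ?case
  proof cases
    case 1
    with ij show ?thesis by (intro exI[of _ i] exI[of _ "Suc j"]) auto
  next
    case 2
    with ij show ?thesis by (intro exI[of _ "Suc i"] exI[of _ j]) auto
  qed
qed

text \<open>Together with its mirror image below, this supplies the walk for the upper bound on
  product distances.\<close>

lemma (in pair_wf_digraph) relpow_cartesian_product_left:
  assumes "(v, w) \<in> parcs G ^^ i" and "u \<in> pverts H"
  shows "((v, u), (w, u)) \<in> parcs (cartesian_product G H) ^^ i"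
  using assms(1)
proof (induction i arbitrary: w)
  case (Suc i)
  from Suc.prems obtain z where z: "(v, z) \<in> parcs G ^^ i" "(z, w) \<in> parcs G"
    by auto
  have "((z, u), (w, u)) \<in> parcs (cartesian_product G H)"
    using z(2) assms(2) by (auto intro: wellformed')
  with Suc.IH[OF z(1)] show ?case
    by (rule relpow_Suc_I)
qed simp

lemma (in pair_wf_digraph) relpow_cartesian_product_right:
  assumes "(u, t) \<in> parcs G ^^ j" and "v \<in> pverts H"
  shows "((v, u), (v, t)) \<in> parcs (cartesian_product H G) ^^ j"
  using assms(1)
proof (induction j arbitrary: t)
  case (Suc j)
  from Suc.prems obtain z where z: "(u, z) \<in> parcs G ^^ j" "(z, t) \<in> parcs G"
    by auto
  have "((v, z), (v, t)) \<in> parcs (cartesian_product H G)"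
    using z(2) assms(2) by (auto intro: wellformed')
  with Suc.IH[OF z(1)] show ?case
    by (rule relpow_Suc_I)
qed simp

lemma graph_dist_cartesian_product:
  assumes "pair_wf_digraph G" and "pair_wf_digraph H"
    and vw: "v \<rightarrow>\<^sup>*\<^bsub>with_proj G\<^esub> w" and ut: "u \<rightarrow>\<^sup>*\<^bsub>with_proj H\<^esub> t"
  shows "graph_dist (cartesian_product G H) (v, u) (w, t) = graph_dist G v w + graph_dist H u t"
proof -
  interpret G: pair_wf_digraph G by fact
  interpret H: pair_wf_digraph H by fact
  interpret P: pair_wf_digraph "cartesian_product G H"
    by (rule pair_wf_digraph_cartesian_product)
  have verts: "v \<in> pverts G" "w \<in> pverts G" "u \<in> pverts H"
    using vw ut by (auto dest: G.reachable_in_verts H.reachable_in_verts)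
  \<comment> \<open>First move from \<open>v\<close> to \<open>w\<close> with \<open>u\<close>
    fixed, then from \<open>u\<close> to \<open>t\<close> with \<open>w\<close> fixed.\<close>
  have walk: "((v, u), (w, t)) \<in> parcs (cartesian_product G H) ^^ (graph_dist G v w + graph_dist H u t)"
    using G.relpow_cartesian_product_left[OF G.reachable_graph_dist_relpow[OF vw], of u H]
      H.relpow_cartesian_product_right[OF H.reachable_graph_dist_relpow[OF ut], of w G] verts
    by (auto simp: relpow_add)
  show ?thesis
  proof (rule antisym)
    show "graph_dist (cartesian_product G H) (v, u) (w, t) \<le> graph_dist G v w + graph_dist H u t"
      using walk verts by (intro P.graph_dist_le) auto
  next
    have "((v, u), (w, t)) \<in>
        parcs (cartesian_product G H) ^^ graph_dist (cartesian_product G H) (v, u) (w, t)"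
      using walk verts by (intro P.graph_dist_relpow) auto
    from relpow_cartesian_product_split[OF this] obtain i j
      where "i + j = graph_dist (cartesian_product G H) (v, u) (w, t)"
        "(v, w) \<in> parcs G ^^ i" "(u, t) \<in> parcs H ^^ j"
      by blast
    with verts show "graph_dist G v w + graph_dist H u t \<le>
        graph_dist (cartesian_product G H) (v, u) (w, t)"
      using G.graph_dist_le[of v w i] H.graph_dist_le[of u t j] by linarith
  qed
qed

lemma graph_dist_complete_digraph:
  assumes "complete_digraph n (with_proj K)" and "u \<in> pverts K" and "t \<in> pverts K"
  shows "u \<rightarrow>\<^sup>*\<^bsub>with_proj K\<^esub> t"
    and "graph_dist K u t = (if u = t then 0 else 1)"
proof -
  interpret pair_graph K
    using assms(1) by (rule pair_graphI_complete)
  have arc: "(u, t) \<in> parcs K" if "u \<noteq> t"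
    using that assms by (auto simp: complete_digraph_pair_def)
  show *: "u \<rightarrow>\<^sup>*\<^bsub>with_proj K\<^esub> t"
    using arc assms(2) by (cases "u = t") auto
  have "graph_dist K u t \<le> (if u = t then 0 else 1)"
    using assms(2) arc by (intro graph_dist_le) auto
  \<comment> \<open>The zeroth power of the arc relation is the identity, so distance 0 would force
    \<open>u = t\<close>.\<close>
  moreover have "graph_dist K u t \<noteq> 0" if "u \<noteq> t"
    using reachable_graph_dist_relpow[OF *] that by (cases "graph_dist K u t") auto
  ultimately show "graph_dist K u t = (if u = t then 0 else 1)"
    by (auto split: if_splits)
qed

section \<open>Characteristic polynomials\<close>

text \<open>Allows characteristic polynomials to be compared pointwise, through determinants of
  scalar matrices.\<close>

lemma poly_char_poly:
  fixes A :: "'a :: field mat"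
  assumes "A \<in> carrier_mat n n"
  shows "poly (char_poly A) k = det (k \<cdot>\<^sub>m 1\<^sub>m n - A)"
proof -
  have "- char_matrix A k = k \<cdot>\<^sub>m 1\<^sub>m n - A"
    by (rule eq_matI) (use assms in \<open>auto simp: char_matrix_def\<close>)
  then show ?thesis
    using char_poly_matrix[OF assms] by simp
qed

text \<open>Permuting the rows and then the columns contributes the sign of \<open>p\<close> twice,
  and its square is 1.\<close>

lemma char_poly_reindex_permutes:
  fixes A :: "'a :: comm_ring_1 mat"
  assumes A: "A \<in> carrier_mat n n" and p: "p permutes {0..<n}"
  shows "char_poly (mat n n (\<lambda>(i, j). A $$ (p i, p j))) = char_poly A"
proof -
  let ?C = "char_poly_matrix A"
  let ?R = "mat n n (\<lambda>(i, j). ?C $$ (p i, j))"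
  have C: "?C \<in> carrier_mat n n" using A by simp
  have R: "?R\<^sup>T \<in> carrier_mat n n" by simp
  have pl: "p i < n" if "i < n" for i
    using permutes_in_image[OF p, of i] that by simp
  have inj: "p i = p j \<longleftrightarrow> i = j" for i j
    using permutes_inj[OF p] by (auto dest: injD)
  \<comment> \<open>\<open>det_permute_rows\<close> acts on rows, so the columns are permuted
    through a transpose. Injectivity of \<open>p\<close> keeps the indeterminate on the
    diagonal.\<close>
  have "char_poly_matrix (mat n n (\<lambda>(i, j). A $$ (p i, p j)))
      = (mat n n (\<lambda>(i, j). ?R\<^sup>T $$ (p i, j)))\<^sup>T"
    by (rule eq_matI) (use A pl inj in \<open>auto simp: char_poly_matrix_def\<close>)
  then have "char_poly (mat n n (\<lambda>(i, j). A $$ (p i, p j)))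
      = det (mat n n (\<lambda>(i, j). ?R\<^sup>T $$ (p i, j)))"
    unfolding char_poly_def by (simp add: det_transpose[of _ n])
  also have "\<dots> = signof p * (signof p * det ?C)"
    by (simp only: det_permute_rows[OF R p] det_transpose[of ?R n] mat_carrier det_permute_rows[OF C p])
  also have "\<dots> = det ?C"
    by (simp add: sign_def)
  finally show ?thesis by (simp add: char_poly_def)
qed

text \<open>Two enumerations of one set differ by a permutation of positions. A convenient vertex
  order therefore suffices, although the eigenvalue predicates quantify over all of them.\<close>

lemma char_poly_enumeration_cong:
  fixes f :: "'b \<Rightarrow> 'b \<Rightarrow> 'a :: comm_ring_1"
  assumes "distinct vs" "distinct ws" "set vs = set ws"
  shows "char_poly (mat (length vs) (length vs) (\<lambda>(i, j). f (vs ! i) (vs ! j))) =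
    char_poly (mat (length ws) (length ws) (\<lambda>(i, j). f (ws ! i) (ws ! j)))"
proof -
  have "mset vs = mset ws"
    using assms by (simp add: set_eq_iff_mset_eq_distinct)
  then obtain p where p: "p permutes {..<length ws}" "permute_list p ws = vs"
    by (rule mset_eq_permutation)
  have len: "length vs = length ws" using p(2) by auto
  have p': "p permutes {0..<length ws}" using p(1) by (simp add: lessThan_atLeast0)
  have pl: "p i < length ws" if "i < length ws" for i
    using permutes_in_image[OF p(1), of i] that by simp
  have nth: "vs ! i = ws ! p i" if "i < length ws" for i
    using permute_list_nth[OF p(1) that] p(2) by simp
  let ?W = "mat (length ws) (length ws) (\<lambda>(i, j). f (ws ! i) (ws ! j))"
  have "mat (length vs) (length vs) (\<lambda>(i, j). f (vs ! i) (vs ! j)) =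
      mat (length ws) (length ws) (\<lambda>(i, j). ?W $$ (p i, p j))"
    by (rule eq_matI) (auto simp: len nth pl)
  then show ?thesis
    using char_poly_reindex_permutes[OF _ p', of ?W] by simp
qed

text \<open>Conjugation by \<open>?L\<close>, whose inverse is \<open>?R\<close>, makes the matrix
  block triangular with diagonal blocks \<open>A + B\<close> and \<open>A - B\<close>.\<close>

lemma char_poly_symmetric_block:
  fixes A B :: "'a :: field_char_0 mat"
  assumes A: "A \<in> carrier_mat n n" and B: "B \<in> carrier_mat n n"
  shows "char_poly (four_block_mat A B B A) = char_poly (A + B) * char_poly (A - B)"
proof -
  let ?L = "four_block_mat (1\<^sub>m n) (1\<^sub>m n) (0\<^sub>m n n) (1\<^sub>m n) :: 'a mat"
  let ?R = "four_block_mat (1\<^sub>m n) (- 1\<^sub>m n) (0\<^sub>m n n) (1\<^sub>m n) :: 'a mat"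
  let ?M = "four_block_mat A B B A"
  let ?T = "four_block_mat (A + B) (0\<^sub>m n n) B (A - B)"
  have one: "1\<^sub>m (n + n) = four_block_mat (1\<^sub>m n) (0\<^sub>m n n) (0\<^sub>m n n) (1\<^sub>m n :: 'a mat)"
    by simp
  note mult = mult_four_block_mat[where ?nr1.0 = n and ?n1.0 = n and ?n2.0 = n and ?nr2.0 = n
      and ?nc1.0 = n and ?nc2.0 = n]
  have neg: "1\<^sub>m n + - 1\<^sub>m n = (0\<^sub>m n n :: 'a mat)"
    "- 1\<^sub>m n + 1\<^sub>m n = (0\<^sub>m n n :: 'a mat)" "- 0\<^sub>m n n = (0\<^sub>m n n :: 'a mat)"
    by (auto intro!: eq_matI)
  have LR: "?L * ?R = 1\<^sub>m (n + n)"
    unfolding one by (subst mult) (auto intro!: cong_four_block_mat simp: neg)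
  have RL: "?R * ?L = 1\<^sub>m (n + n)"
    unfolding one by (subst mult) (auto intro!: cong_four_block_mat simp: neg)
  \<comment> \<open>\<open>?L\<close> adds the second block row to the first; \<open>?R\<close> then
    subtracts the first block column from the second, which clears the upper right block.\<close>
  have "?L * ?M = four_block_mat (A + B) (A + B) B A"
    by (subst mult) (use A B in \<open>auto intro!: cong_four_block_mat simp: comm_add_mat\<close>)
  then have "?L * ?M * ?R = ?T"
    by (simp only:) (subst mult, use A B in \<open>auto intro!: cong_four_block_mat\<close>)
  then have "similar_mat ?T ?M"
    using A B LR RL by (intro similar_matI[of _ _ ?L ?R "n + n"]) auto
  then have "char_poly ?M = char_poly ?T"
    by (rule char_poly_similar[symmetric])
  also have "\<dots> = char_poly (A + B) * char_poly (A - B)"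
  proof -
    \<comment> \<open>The indeterminate enters only the diagonal blocks, so the triangular shape
      survives.\<close>
    have "char_poly_matrix ?T = four_block_mat (char_poly_matrix (A + B)) (0\<^sub>m n n)
        (map_mat (\<lambda>a. [:- a:]) B) (char_poly_matrix (A - B))"
      by (rule eq_matI) (use A B in \<open>auto simp: char_poly_matrix_def\<close>)
    then show ?thesis
      unfolding char_poly_def
      using add_carrier_mat[OF B, of A] minus_carrier_mat[OF B, of A] B
      by (simp add: det_four_block_mat_upper_right_zero[of _ n _ n])
  qed
  finally show ?thesis .
qed

section \<open>Eigenvalue multisets\<close>

text \<open>Compares degrees. The count is what later spreads the factor \<open>a ^ n\<close> of a
  scaled determinant over the eigenvalues.\<close>

lemma eigenvalue_multiset_size:
  assumes "A \<in> carrier_mat n n" and "eigenvalue_multiset A M"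
  shows "size M = n"
proof -
  have "degree (\<Prod>e\<in>#M. [:- e, 1:]) = size M"
    by (induction M) (simp_all add: degree_mult_eq prod_mset_zero_iff image_iff del: mult_pCons_left)
  then show ?thesis
    using assms degree_monic_char_poly[OF assms(1)] by (simp add: eigenvalue_multiset_def)
qed

lemma eigenvalue_multiset_affine:
  assumes A: "A \<in> carrier_mat n n" and M: "eigenvalue_multiset A M" and "a \<noteq> 0"
  shows "eigenvalue_multiset (c \<cdot>\<^sub>m 1\<^sub>m n + a \<cdot>\<^sub>m A) (image_mset (\<lambda>e. c + a * e) M)"
proof -
  let ?B = "c \<cdot>\<^sub>m 1\<^sub>m n + a \<cdot>\<^sub>m A"
  have "poly (char_poly ?B) k = poly (\<Prod>e\<in>#image_mset (\<lambda>e. c + a * e) M. [:- e, 1:]) k" for k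
  proof -
    \<comment> \<open>The preimage of \<open>k\<close> under the affine map: at \<open>k\<close> the
      shifted matrix is \<open>a\<close> times the original one shifted by \<open>x\<close>.\<close>
    define x where "x = (k - c) / a"
    have k: "k = c + a * x" using \<open>a \<noteq> 0\<close> by (simp add: x_def)
    have "k \<cdot>\<^sub>m 1\<^sub>m n - ?B = a \<cdot>\<^sub>m (x \<cdot>\<^sub>m 1\<^sub>m n - A)"
      by (rule eq_matI) (use A in \<open>auto simp: k algebra_simps\<close>)
    then have "poly (char_poly ?B) k = a ^ n * poly (char_poly A) x"
      using A by (simp add: poly_char_poly[of _ n])
    also have "\<dots> = a ^ size M * (\<Prod>e\<in>#M. x - e)"
      using M eigenvalue_multiset_size[OF A M]
      by (simp add: eigenvalue_multiset_def poly_prod_mset)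
    also have "\<dots> = (\<Prod>e\<in>#M. a * x - a * e)"
      by (induction M) (auto simp: algebra_simps)
    also have "\<dots> = poly (\<Prod>e\<in>#image_mset (\<lambda>e. c + a * e) M. [:- e, 1:]) k"
      by (simp add: poly_prod_mset k multiset.map_comp o_def)
    finally show ?thesis .
  qed
  \<comment> \<open>Real polynomials that agree at every point are equal.\<close>
  then show ?thesis
    unfolding eigenvalue_multiset_def by (simp add: poly_eq_poly_eq_iff[symmetric] fun_eq_iff)
qed

lemma eigenvalue_multiset_all_ones:
  assumes "n \<noteq> 0"
  shows "eigenvalue_multiset (all_ones_mat n) ({# real n #} + replicate_mset (n - 1) 0)"
proof -
  let ?J = "all_ones_mat n"
  \<comment> \<open>\<open>E 1\<close> replaces the first unit vector by the all-ones vector, which spans the image of \<open>J\<close>.\<close>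
  define E where "E s =
    (mat n n (\<lambda>(i, j). (if i = j then 1 else 0) + (if j = 0 \<and> i \<noteq> 0 then s else 0)) :: real mat)"
    for s
  \<comment> \<open>\<open>U\<close> is \<open>J\<close> in the new basis: the all-ones vector goes
    to \<open>n\<close> times itself and each remaining unit vector goes to the all-ones vector, so
    only row 0 is nonzero.\<close>
  define U where "U = (mat n n (\<lambda>(i, j). if i = 0 then if j = 0 then real n else 1 else 0) :: real mat)"
  have carr: "E s \<in> carrier_mat n n" "U \<in> carrier_mat n n" "?J \<in> carrier_mat n n" for s
    by (auto simp: E_def U_def all_ones_mat_def)
  \<comment> \<open>Left multiplication by \<open>E s\<close> adds \<open>s\<close> times row 0 to
    every other row, hence \<open>E (- s)\<close> is its inverse.\<close>
  have EX: "(E s * X) $$ (i, j) = X $$ (i, j) + (if i \<noteq> 0 then s * X $$ (0, j) else 0)"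
    if "X \<in> carrier_mat n n" "i < n" "j < n" for s X i j
  proof -
    have "(E s * X) $$ (i, j) = (\<Sum>k = 0..<n. (if i = k then X $$ (k, j) else 0)
        + (if k = 0 then if i \<noteq> 0 then s * X $$ (k, j) else 0 else 0))"
      using that by (auto simp: E_def scalar_prod_def algebra_simps intro!: sum.cong)
    also have "\<dots> = X $$ (i, j) + (if i \<noteq> 0 then s * X $$ (0, j) else 0)"
      unfolding sum.distrib using that by simp
    finally show ?thesis .
  qed
  have inv: "E s * E (- s) = 1\<^sub>m n" for s
    by (rule eq_matI) (use carr in \<open>auto simp del: index_mult_mat(1) simp: EX\<close>, auto simp: E_def)
  have "?J * E 1 = E 1 * U"
  proof (rule eq_matI)
    fix i j assume "i < dim_row (E 1 * U)" "j < dim_col (E 1 * U)"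
    then have ij: "i < n" "j < n" by (auto simp: E_def U_def)
    have "(?J * E 1) $$ (i, j) = (\<Sum>k = 0..<n. if j = 0 then 1 else if k = j then 1 else 0)"
      using ij by (auto simp: E_def all_ones_mat_def scalar_prod_def intro!: sum.cong)
    also have "\<dots> = (if j = 0 then real n else 1)"
      using ij by simp
    also have "\<dots> = (E 1 * U) $$ (i, j)"
      using ij assms carr by (subst EX) (auto simp: U_def)
    finally show "(?J * E 1) $$ (i, j) = (E 1 * U) $$ (i, j)" .
  qed (auto simp: E_def U_def all_ones_mat_def)
  moreover have "?J * E 1 * E (- 1) = ?J"
    using inv[of 1] carr by (simp add: assoc_mult_mat[of _ n n _ n _ n])
  ultimately have "?J = E 1 * U * E (- 1)"
    by simp
  then have "similar_mat ?J U"
    using carr inv[of 1] inv[of "- 1"] by (intro similar_matI[of _ _ "E 1" "E (- 1)" n]) auto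
  then have "char_poly ?J = char_poly U"
    by (rule char_poly_similar)
  also have "\<dots> = (\<Prod>e\<leftarrow>diag_mat U. [:- e, 1:])"
    using carr by (intro char_poly_upper_triangular[of _ n]) (auto simp: U_def)
  also have "diag_mat U = real n # replicate (n - 1) 0"
    using assms by (auto simp: diag_mat_def U_def list_eq_iff_nth_eq nth_Cons')
  finally show ?thesis
    by (simp add: eigenvalue_multiset_def)
qed

section \<open>The distance Seidel spectrum of \<open>G \<times> K2\<close>\<close>

lemma char_poly_distance_seidel_matrix_cong:
  assumes "vertex_enumeration G vs" "vertex_enumeration G ws"
  shows "char_poly (distance_seidel_matrix G vs) = char_poly (distance_seidel_matrix G ws)"
proof -
  \<comment> \<open>The identity matrix compares positions, the function compares vertices; they
    agree because \<open>us\<close> is distinct.\<close>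
  have eq: "distance_seidel_matrix G us = mat (length us) (length us)
      (\<lambda>(i, j). (\<lambda>x y. 1 - (if x = y then 1 else 0) - 2 * real (graph_dist G x y)) (us ! i) (us ! j))"
    if "distinct us" for us
    by (rule eq_matI)
      (use that in \<open>auto simp: distance_seidel_matrix_def all_ones_mat_def distance_matrix_def nth_eq_iff_index_eq\<close>)
  show ?thesis
    using assms unfolding vertex_enumeration_def
    by (simp only: eq) (rule char_poly_enumeration_cong, auto)
qed

theorem theorem6p4:
  fixes G :: "'a pair_pre_digraph" and K2 :: "'b pair_pre_digraph"
    and n :: nat and \<theta> :: "nat \<Rightarrow> real"
  assumes "distance_regular G"
    and "card (pverts G) = n"
    and "distance_eigenvalues G (image_mset \<theta> (mset_set {1..n}))"
    and "complete_digraph 2 (with_proj K2)"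
  shows "distance_seidel_eigenvalues (cartesian_product G K2)
           (image_mset (\<lambda>r. - 1 - 4 * \<theta> r) (mset_set {1..n})
            + {# 2 * real n - 1 #}
            + replicate_mset (n - 1) (- 1))"
proof -
  let ?P = "cartesian_product G K2"
  interpret G: pair_graph G
    using assms(1) by (simp add: distance_regular_def)
  interpret K: pair_graph K2
    using assms(4) by (rule pair_graphI_complete)
  have conn: "Digraph_Component.connected (with_proj G)"
    using assms(1) by (simp add: distance_regular_def)
  \<comment> \<open>Connectedness speaks of the symmetric closure; since the arcs are symmetric,
    reachability there is reachability in \<open>G\<close>.\<close>
  then have reach: "v \<rightarrow>\<^sup>*\<^bsub>with_proj G\<^esub> w" if "v \<in> pverts G" "w \<in> pverts G" for v w
    using that G.reachable_mk_symmetric_eq[OF G.sym_arcs]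
    by (auto simp: connected_def strongly_connected_def)
  \<comment> \<open>Connectedness excludes the empty graph, so \<open>n - 1\<close> is not
    truncated.\<close>
  have n: "n \<noteq> 0"
    using conn assms(2) G.pair_finite_verts by (auto simp: connected_def strongly_connected_def)
  obtain us where us: "distinct us" "set us = pverts G"
    using finite_distinct_list[OF G.pair_finite_verts] by blast
  have len: "length us = n"
    using us assms(2) distinct_card by fastforce
  obtain a b where ab: "pverts K2 = {a, b}" "a \<noteq> b"
    using assms(4) by (auto simp: complete_digraph_pair_def card_2_iff)
  define ws where "ws = map (\<lambda>v. (v, a)) us @ map (\<lambda>v. (v, b)) us"
  have ws: "vertex_enumeration ?P ws"
    using us ab by (auto simp: vertex_enumeration_def ws_def distinct_map inj_on_def)
  have dist: "graph_dist ?P (v, x) (w, y) = graph_dist G v w + (if x = y then 0 else 1)"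
    if "v \<in> pverts G" "w \<in> pverts G" "x \<in> {a, b}" "y \<in> {a, b}" for v w x y
    using that ab graph_dist_complete_digraph[OF assms(4)]
    by (subst graph_dist_cartesian_product) (auto intro: reach)

  define D where "D = distance_matrix G us"
  \<comment> \<open>Within a copy of \<open>G\<close> the distances are \<open>D\<close>. Across
    copies each grows by 1 and the identity contributes nothing, so \<open>B\<close> is
    \<open>J - 2 (D + J) = - J - 2 D\<close>.\<close>
  define A where "A = all_ones_mat n - 1\<^sub>m n - 2 \<cdot>\<^sub>m D"
  define B where "B = - all_ones_mat n - 2 \<cdot>\<^sub>m D"
  have carr: "D \<in> carrier_mat n n" "all_ones_mat n \<in> carrier_mat n n"
    "A \<in> carrier_mat n n" "B \<in> carrier_mat n n"
    by (auto simp: D_def A_def B_def distance_matrix_def all_ones_mat_def len)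
  have in_G: "us ! i \<in> pverts G" if "i < n" for i
    using that us len by (metis nth_mem)
  have block: "distance_seidel_matrix ?P ws = four_block_mat A B B A"
  proof (rule eq_matI)
    fix i j
    assume "i < dim_row (four_block_mat A B B A)" "j < dim_col (four_block_mat A B B A)"
    then have ij: "i < n + n" "j < n + n"
      using carr by auto
    show "distance_seidel_matrix ?P ws $$ (i, j) = four_block_mat A B B A $$ (i, j)"
      using ij ab(2) carr
      by (cases "i < n"; cases "j < n")
        (auto simp: distance_seidel_matrix_def all_ones_mat_def distance_matrix_def A_def B_def D_def
          ws_def len nth_append dist in_G)
  qed (use carr in \<open>auto simp: distance_seidel_matrix_def distance_matrix_def all_ones_mat_def ws_def len\<close>)
  have sum: "A + B = (- 1) \<cdot>\<^sub>m 1\<^sub>m n + (- 4) \<cdot>\<^sub>m D"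
    by (rule eq_matI) (use carr in \<open>auto simp: A_def B_def all_ones_mat_def\<close>)
  have diff: "A - B = (- 1) \<cdot>\<^sub>m 1\<^sub>m n + 2 \<cdot>\<^sub>m all_ones_mat n"
    by (rule eq_matI) (use carr in \<open>auto simp: A_def B_def all_ones_mat_def\<close>)

  have "eigenvalue_multiset D (image_mset \<theta> (mset_set {1..n}))"
    using assms(3) us by (simp add: distance_eigenvalues_def vertex_enumeration_def D_def)
  from eigenvalue_multiset_affine[OF carr(1) this, of "- 4" "- 1"]
  have ev_sum: "eigenvalue_multiset (A + B) (image_mset (\<lambda>r. - 1 - 4 * \<theta> r) (mset_set {1..n}))"
    by (simp add: sum multiset.map_comp o_def)
  \<comment> \<open>The map sending \<open>e\<close> to \<open>2 e - 1\<close> takes the eigenvalue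
    \<open>n\<close> of \<open>J\<close> to \<open>2 n - 1\<close> and the \<open>n - 1\<close>
    zeros to \<open>- 1\<close>.\<close>
  from eigenvalue_multiset_affine[OF carr(2) eigenvalue_multiset_all_ones[OF n], of 2 "- 1"]
  have ev_diff: "eigenvalue_multiset (A - B) ({# 2 * real n - 1 #} + replicate_mset (n - 1) (- 1))"
    by (simp add: diff)
  show ?thesis
    unfolding distance_seidel_eigenvalues_def eigenvalue_multiset_def
  proof (intro allI impI)
    fix vs
    assume "vertex_enumeration ?P vs"
    then have "char_poly (distance_seidel_matrix ?P vs) = char_poly (A + B) * char_poly (A - B)"
      using char_poly_distance_seidel_matrix_cong[OF _ ws] block char_poly_symmetric_block carr
      by metis
    then show "char_poly (distance_seidel_matrix ?P vs) =
        (\<Prod>e\<in>#image_mset (\<lambda>r. - 1 - 4 * \<theta> r) (mset_set {1..n}) + {# 2 * real n - 1 #}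
            + replicate_mset (n - 1) (- 1). [:- e, 1:])"
      using ev_sum ev_diff
      by (simp only: eigenvalue_multiset_def image_mset_union prod_mset.union add.assoc)
  qed
qed

end
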